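(* Let $m\ge 2$ be an integer. Then $$\mathcal{S}^*_m=\mathcal{V}_m=\mathcal{W}_m\quad\text{and}\quad\widetilde{\mathcal{S}^*_m}=\mathcal{Y}_m=\widetilde{\mathcal{V}_m}=\widetilde{\mathcal{W}_m}.$$ In particular, the set $\mathcal{S}^*_m$ of the inverses of Sós permutations of degree $m$ coincides with $\mathcal{V}_m$, and the set $\widetilde{\mathcal{S}^*_m}$ of the inverses of permutations of Sós-type of degree $m$ is $\mathcal{Y}_m$.
   Context: $[m]=\{1,\dots,m\}$ and $\mathfrak{S}_m$ is the set of all bijections $[m]\to[m]$. For real $x$, $\{x\}=x-\lfloor x\rfloor$. For a predicate $P$, $\mathbf{1}(P)=1$ if $P$ is true and $0$ if $P$ is false. A permutation $\sigma\in\mathfrak{S}_m$ is a Sós permutation if there is a real $\alpha$ with $0<\{\sigma(1)\alpha\}<\{\sigma(2)\alpha\}<\cdots<\{\sigma(m)\alpha\}<1$. $\mathcal{S}_m$ is the set of Sós permutations of degree $m$, and $\mathcal{S}^*_m=\{\sigma^{-1}:\sigma\in\mathcal{S}_m\}$. A permutation $\sigma\in\mathfrak{S}_m$ is of Sós-type if there are reals $\alpha,\beta$ with $0<\{\sigma(1)\alpha+\beta\}<\{\sigma(2)\alpha+\beta\}<\cdots<\{\sigma(m)\alpha+\beta\}<1$; the set of inverses of permutations of Sós-type is identified with the shift-closure $\widetilde{\mathcal{S}^*_m}$ defined below. $$\mathcal{V}_m=\{\theta\in\mathfrak{S}_m:\ \theta(i+1)-\theta(i)\equiv\theta(1)-\mathbf{1}(\theta(m)\le\theta(i))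 \pmod m\ \text{ for all } i\in[m-1]\},$$ $$\mathcal{W}_m=\{\theta\in\mathfrak{S}_m:\ \theta(i+1)-\theta(i)=\theta(1)-\mathbf{1}(\theta(m)\le\theta(i))+m(\mathbf{1}(\theta(i)\le\theta(i+1))-1)\ \text{ for all } i\in[m-1]\}.$$ For $\theta\in\mathfrak{S}_m$ and $i\in[m-1]$ put $$\Delta_\theta(i)=\theta(i+1)-\theta(i)+\mathbf{1}(\theta(m)\le\theta(i))-\mathbf{1}(\theta(1)\le\theta(i+1))-(m-1)\mathbf{1}(\theta(i)\le\theta(i+1)).$$ For $m\ge 3$, $\mathcal{Y}_m=\{\theta\in\mathfrak{S}_m:\ \Delta_\theta(i+1)-\Delta_\theta(i)=0\ \text{ for all } i\in[m-2]\}$, and $\mathcal{Y}_2=\mathfrak{S}_2$. For $\theta,\theta'\in\mathfrak{S}_m$ write $\theta\sim\theta'$ (shift-equivalent) if there is $k\in[m]$ with $\theta'(i)\equiv\theta(i)+k\pmod m$ for all $i\in[m]$. For $T\subset\mathfrak{S}_m$, the shift-closure is $\widetilde{T}=\{\theta'\in\mathfrak{S}_m:\ \exists\,\theta\in T,\ \theta\sim\theta'\}$. *)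

theory Defs
  imports Complex_Main "HOL-Number_Theory.Cong" "HOL-Combinatorics.Permutations"
begin

text \<open>
  A bijection of \<open>[m] = {1..m}\<close> is a function \<open>\<theta> :: nat \<Rightarrow> nat\<close> with \<open>\<theta> permutes {1..m}\<close>, that is,
  one extended by the identity outside \<open>{1..m}\<close>. With this convention \<open>inv \<theta>\<close> is the inverse
  permutation and equality of functions is equality of permutations of \<open>[m]\<close>. Differences of
  values are taken in the integers.
\<close>

definition Sym :: "nat \<Rightarrow> (nat \<Rightarrow> nat) set" where
  "Sym m = {\<theta>. \<theta> permutes {1..m}}"

text \<open>The chain \<open>0 < f 1 < f 2 < \<dots> < f m < 1\<close> (for \<open>m \<ge> 1\<close>).\<close>

definition unit_chain :: "nat \<Rightarrow> (nat \<Rightarrow> real) \<Rightarrow> bool" where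
  "unit_chain m f \<longleftrightarrow> 0 < f 1 \<and> (\<forall>i\<in>{1..m-1}. f i < f (i+1)) \<and> f m < 1"

definition sos :: "nat \<Rightarrow> (nat \<Rightarrow> nat) set" where
  "sos m = {\<sigma> \<in> Sym m. \<exists>\<alpha>::real. unit_chain m (\<lambda>i. frac (real (\<sigma> i) * \<alpha>))}"

definition sos_inv :: "nat \<Rightarrow> (nat \<Rightarrow> nat) set" where
  "sos_inv m = {inv \<sigma> | \<sigma>. \<sigma> \<in> sos m}"

definition sos_type :: "nat \<Rightarrow> (nat \<Rightarrow> nat) set" where
  "sos_type m = {\<sigma> \<in> Sym m. \<exists>\<alpha> \<beta>::real. unit_chain m (\<lambda>i. frac (real (\<sigma> i) * \<alpha> + \<beta>))}"

definition sos_type_inv :: "nat \<Rightarrow> (nat \<Rightarrow> nat) set" where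
  "sos_type_inv m = {inv \<sigma> | \<sigma>. \<sigma> \<in> sos_type m}"

definition V_set :: "nat \<Rightarrow> (nat \<Rightarrow> nat) set" where
  "V_set m = {\<theta> \<in> Sym m. \<forall>i\<in>{1..m-1}.
     [int (\<theta> (i+1)) - int (\<theta> i) = int (\<theta> 1) - of_bool (\<theta> m \<le> \<theta> i)] (mod int m)}"

definition W_set :: "nat \<Rightarrow> (nat \<Rightarrow> nat) set" where
  "W_set m = {\<theta> \<in> Sym m. \<forall>i\<in>{1..m-1}.
     int (\<theta> (i+1)) - int (\<theta> i) =
       int (\<theta> 1) - of_bool (\<theta> m \<le> \<theta> i) + int m * (of_bool (\<theta> i \<le> \<theta> (i+1)) - 1)}"

definition Delta :: "nat \<Rightarrow> (nat \<Rightarrow> nat) \<Rightarrow> nat \<Rightarrow> int" where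
  "Delta m \<theta> i = int (\<theta> (i+1)) - int (\<theta> i) + of_bool (\<theta> m \<le> \<theta> i)
     - of_bool (\<theta> 1 \<le> \<theta> (i+1)) - (int m - 1) * of_bool (\<theta> i \<le> \<theta> (i+1))"

text \<open>Only meaningful for \<open>m \<ge> 2\<close>.\<close>

definition Y_set :: "nat \<Rightarrow> (nat \<Rightarrow> nat) set" where
  "Y_set m = (if m = 2 then Sym 2
     else {\<theta> \<in> Sym m. \<forall>i\<in>{1..m-2}. Delta m \<theta> (i+1) - Delta m \<theta> i = 0})"

definition shift_equiv :: "nat \<Rightarrow> (nat \<Rightarrow> nat) \<Rightarrow> (nat \<Rightarrow> nat) \<Rightarrow> bool" where
  "shift_equiv m \<theta> \<theta>' \<longleftrightarrow> (\<exists>k\<in>{1..m}. \<forall>i\<in>{1..m}. [\<theta>' i = \<theta> i + k] (mod m))"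

definition shift_closure :: "nat \<Rightarrow> (nat \<Rightarrow> nat) set \<Rightarrow> (nat \<Rightarrow> nat) set" where
  "shift_closure m T = {\<theta>' \<in> Sym m. \<exists>\<theta>\<in>T. shift_equiv m \<theta> \<theta>'}"

end

(*
  Let x_i = frac (i alpha + beta). Comparing x_{i+1} with x_{j+1} amounts to comparing x_i with x_j,
  corrected by the wrap-arounds at i and j. Summation over j yields the defining identities of W_set
  (beta = 0) and Y_set. Conversely, let theta be in W_set. The numbers i alpha minus the number of
  descents of theta before i must be shown to be sorted by theta in (0, 1) for some alpha. As in
  the three gap theorem, stepping back from i to i - 1 shows that every gap between neighbours
  is one of the two gaps at the ends of [0, 1] or a sum of two of these, and alpha can be chosen such
  that both are positive. Finally an element of Y_set moves its values by a rotation of m - 1 ranks;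
  cutting the circle at the right place turns it into an element of V_set.
*)

theory Submission
  imports Defs
begin

subsection \<open>Permutations and the order of a finite sequence\<close>

lemma Sym_facts:
  assumes "\<theta> \<in> Sym m"
  shows "\<theta> permutes {1..m}" "inv \<theta> \<in> Sym m" "inj \<theta>" "inv (inv \<theta>) = \<theta>"
    "\<And>i. inv \<theta> (\<theta> i) = i" "\<And>i. \<theta> (inv \<theta> i) = i" "\<theta> 0 = 0" "inv \<theta> 0 = 0"
    "\<And>i. i \<in> {1..m} \<Longrightarrow> \<theta> i \<in> {1..m}" "\<And>i. i \<in> {1..m} \<Longrightarrow> inv \<theta> i \<in> {1..m}"
    "\<And>i j. \<theta> i = \<theta> j \<longleftrightarrow> i = j"
proof -
  show p: "\<theta> permutes {1..m}" using assms by (simp add: Sym_def)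
  have q: "inv \<theta> permutes {1..m}" using p by (rule permutes_inv)
  then show "inv \<theta> \<in> Sym m" by (simp add: Sym_def)
  show i: "inj \<theta>" using p by (rule permutes_inj)
  show "inv (inv \<theta>) = \<theta>" using p by (rule permutes_inv_inv)
  show "\<And>i. inv \<theta> (\<theta> i) = i" "\<And>i. \<theta> (inv \<theta> i) = i"
    using permutes_inverses[OF p] by auto
  show "\<theta> 0 = 0" "inv \<theta> 0 = 0" using p q by (auto simp: permutes_def)
  show "\<And>i. i \<in> {1..m} \<Longrightarrow> \<theta> i \<in> {1..m}" "\<And>i. i \<in> {1..m} \<Longrightarrow> inv \<theta> i \<in> {1..m}"
    using permutes_in_image[OF p] permutes_in_image[OF q] by blast+
  show "\<And>i j. \<theta> i = \<theta> j \<longleftrightarrow> i = j" using i by (meson injD)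
qed

lemma unit_chain_mono:
  assumes "unit_chain m f" "i < j" "1 \<le> i" "j \<le> m"
  shows "f i < f j"
  using assms(2-4)
proof (induction j)
  case (Suc j)
  have "f j < f (Suc j)" using assms(1) Suc.prems by (auto simp: unit_chain_def)
  then show ?case using Suc by (cases "i = j") auto
qed simp

text \<open>Reindexing by \<open>i = \<sigma> k\<close> turns the chain over positions
  \<open>k\<close> into a comparison of the points \<open>x i\<close> according to their ranks
  \<open>inv \<sigma> i\<close>. Monotonicity spreads the two end inequalities to all
  points.\<close>

lemma unit_chain_iff:
  assumes "\<sigma> \<in> Sym m" "1 \<le> m"
  shows "unit_chain m (\<lambda>i. x (\<sigma> i)) \<longleftrightarrow>
    (\<forall>i\<in>{1..m}. 0 < x i \<and> x i < 1) \<and> (\<forall>i\<in>{1..m}. \<forall>j\<in>{1..m}. inv \<sigma> i < inv \<sigma> j \<longrightarrow> x i < x j)"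
    (is "?L \<longleftrightarrow> ?R")
proof
  note S = Sym_facts[OF assms(1)]
  assume L: ?L
  have mono: "x i < x j" if "i \<in> {1..m}" "j \<in> {1..m}" "inv \<sigma> i < inv \<sigma> j" for i j
    using unit_chain_mono[OF L that(3)] S(10)[OF that(1)] S(10)[OF that(2)] by (simp add: S(6))
  have "0 < x i \<and> x i < 1" if i: "i \<in> {1..m}" for i
  proof -
    define k where "k = inv \<sigma> i"
    have k: "1 \<le> k" "k \<le> m" using S(10)[OF i] by (auto simp: k_def)
    have "x (\<sigma> 1) \<le> x (\<sigma> k)" using unit_chain_mono[OF L, of 1 k] k by (cases "k = 1") auto
    moreover have "x (\<sigma> k) \<le> x (\<sigma> m)" using unit_chain_mono[OF L, of k m] k by (cases "k = m") auto
    ultimately show ?thesis using L by (auto simp: unit_chain_def k_def S(6))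
  qed
  then show ?R using mono by blast
next
  note S = Sym_facts[OF assms(1)]
  assume R: ?R
  have "x (\<sigma> i) < x (\<sigma> (i+1))" if "i \<in> {1..m-1}" for i
    using R S(9)[of i] S(9)[of "i+1"] that by (auto simp: S(5))
  then show ?L using R S(9)[of 1] S(9)[of m] assms(2) by (auto simp: unit_chain_def)
qed

lemma mem_inverses_iff:
  assumes "T \<subseteq> Sym m"
  shows "\<theta> \<in> {inv \<sigma> | \<sigma>. \<sigma> \<in> T} \<longleftrightarrow> \<theta> \<in> Sym m \<and> inv \<theta> \<in> T"
proof
  assume "\<theta> \<in> {inv \<sigma> | \<sigma>. \<sigma> \<in> T}"
  then obtain \<sigma> where "\<theta> = inv \<sigma>" "\<sigma> \<in> T" by blast
  then show "\<theta> \<in> Sym m \<and> inv \<theta> \<in> T" using Sym_facts(2,4)[of \<sigma> m] assms by auto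
next
  assume "\<theta> \<in> Sym m \<and> inv \<theta> \<in> T"
  then show "\<theta> \<in> {inv \<sigma> | \<sigma>. \<sigma> \<in> T}" using Sym_facts(4)[of \<theta> m] by (intro CollectI exI[of _ "inv \<theta>"]) simp
qed

text \<open>For an inverse \<theta> of a permutation of Sos type, \<open>\<theta> i\<close> is the
  rank of the \<open>i\<close>-th point of the rotation among all \<open>m\<close> points. The upper
  bound 1 is absorbed by \<open>frac_lt_1\<close>.\<close>

lemma sos_type_inv_iff:
  assumes "1 \<le> m"
  shows "\<theta> \<in> sos_type_inv m \<longleftrightarrow> \<theta> \<in> Sym m \<and> (\<exists>\<alpha> \<beta>.
    (\<forall>i\<in>{1..m}. 0 < frac (real i * \<alpha> + \<beta>)) \<and>
    (\<forall>i\<in>{1..m}. \<forall>j\<in>{1..m}. \<theta> i < \<theta> j \<longrightarrow> frac (real i * \<alpha> + \<beta>) < frac (real j * \<alpha> + \<beta>)))"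
    (is "_ \<longleftrightarrow> _ \<and> (\<exists>\<alpha> \<beta>. ?P \<alpha> \<beta>)")
proof -
  have "\<theta> \<in> sos_type_inv m \<longleftrightarrow> \<theta> \<in> Sym m \<and> inv \<theta> \<in> sos_type m"
    unfolding sos_type_inv_def by (rule mem_inverses_iff) (auto simp: sos_type_def)
  moreover have "inv \<theta> \<in> sos_type m \<longleftrightarrow> (\<exists>\<alpha> \<beta>. ?P \<alpha> \<beta>)" if \<theta>: "\<theta> \<in> Sym m"
    using unit_chain_iff[OF Sym_facts(2)[OF \<theta>] assms, of "\<lambda>i. frac (real i * \<alpha> + \<beta>)" for \<alpha> \<beta>]
    by (simp add: sos_type_def frac_lt_1 Sym_facts(2,4)[OF \<theta>])
  ultimately show ?thesis by blast
qed

lemma sos_inv_iff: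
  assumes "1 \<le> m"
  shows "\<theta> \<in> sos_inv m \<longleftrightarrow> \<theta> \<in> Sym m \<and> (\<exists>\<alpha>.
    (\<forall>i\<in>{1..m}. 0 < frac (real i * \<alpha>)) \<and>
    (\<forall>i\<in>{1..m}. \<forall>j\<in>{1..m}. \<theta> i < \<theta> j \<longrightarrow> frac (real i * \<alpha>) < frac (real j * \<alpha>)))"
    (is "_ \<longleftrightarrow> _ \<and> (\<exists>\<alpha>. ?P \<alpha>)")
proof -
  have "\<theta> \<in> sos_inv m \<longleftrightarrow> \<theta> \<in> Sym m \<and> inv \<theta> \<in> sos m"
    unfolding sos_inv_def by (rule mem_inverses_iff) (auto simp: sos_def)
  moreover have "inv \<theta> \<in> sos m \<longleftrightarrow> (\<exists>\<alpha>. ?P \<alpha>)" if \<theta>: "\<theta> \<in> Sym m"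
    using unit_chain_iff[OF Sym_facts(2)[OF \<theta>] assms, of "\<lambda>i. frac (real i * \<alpha>)" for \<alpha>]
    by (simp add: sos_def frac_lt_1 Sym_facts(2,4)[OF \<theta>])
  ultimately show ?thesis by blast
qed

lemma sos_invE:
  assumes "\<theta> \<in> sos_inv m" "1 \<le> m"
  obtains \<alpha> where "\<theta> \<in> Sym m" "\<And>i. i \<in> {1..m} \<Longrightarrow> 0 < frac (real i * \<alpha>)"
    "\<And>i j. i \<in> {1..m} \<Longrightarrow> j \<in> {1..m} \<Longrightarrow>
      \<theta> i < \<theta> j \<Longrightarrow> frac (real i * \<alpha>) < frac (real j * \<alpha>)"
  using assms sos_inv_iff[OF assms(2), of \<theta>] by blast

lemma consecutive_in_range:
  assumes "i \<in> {1..m-1::nat}"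
  shows "i \<in> {1..m}" "i + 1 \<in> {1..m}"
  using assms by auto

lemma frac_not_neg: "\<not> frac (x::real) < 0"
  by (simp add: not_less)

text \<open>With \<open>n = \<theta> i\<close> this writes a rank as a count over indices, so that
  identities between ranks follow by summing comparisons of points.\<close>

lemma sum_of_bool_rank:
  assumes "\<theta> \<in> Sym m" "n \<le> m"
  shows "(\<Sum>j=1..m. of_bool (\<theta> j \<le> n)) = int n"
proof -
  have "(\<Sum>j=1..m. of_bool (\<theta> j \<le> n) :: int) = (\<Sum>j=1..m. of_bool (j \<le> n))"
    using sum.permute[OF Sym_facts(1)[OF assms(1)], of "\<lambda>j. of_bool (j \<le> n) :: int"] by (simp add: o_def)
  also have "\<dots> = int (card ({1..m} \<inter> {j. j \<le> n}))" by (simp add: sum_of_bool_eq)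
  also have "{1..m} \<inter> {j. j \<le> n} = {1..n}" using assms(2) by auto
  finally show ?thesis by simp
qed

subsection \<open>Permutations of Sos type lie in \<open>Y_set\<close>\<close>

text \<open>Each of the two ranks counts the points not above its own point. Matching
  \<open>j + 1\<close> in the count for \<open>i + 1\<close> with \<open>j\<close> in the count for
  \<open>i\<close> leaves index 1 on one side and index \<open>m\<close> on the other, which
  explains the two indicator corrections. The sum is the number of wrap-arounds.\<close>

lemma rotation_step:
  assumes \<theta>: "\<theta> \<in> Sym m" and i: "i \<in> {1..m-1}"
    and ord: "\<And>i j. i \<in> {1..m} \<Longrightarrow> j \<in> {1..m} \<Longrightarrow>
      \<theta> i < \<theta> j \<Longrightarrow> frac (real i * \<alpha> + \<beta>) < frac (real j * \<alpha> + \<beta>)"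
  shows "int (\<theta> (i+1)) - of_bool (\<theta> 1 \<le> \<theta> (i+1)) = int (\<theta> i) - of_bool (\<theta> m \<le> \<theta> i)
    + (\<Sum>j=1..m-1. of_bool (\<theta> (j+1) < \<theta> j)) - (int m - 1) * of_bool (\<theta> (i+1) < \<theta> i)"
proof -
  note S = Sym_facts[OF \<theta>]
  define x where "x j = frac (real j * \<alpha> + \<beta>)" for j
  have le: "\<theta> i \<le> \<theta> j \<longleftrightarrow> x i \<le> x j" if "i \<in> {1..m}" "j \<in> {1..m}" for i j
    using ord[OF that] ord[OF that(2,1)] S(11)[of i j] unfolding x_def
    by (metis linorder_neqE_nat nle_le not_less order_less_imp_le)
  have step: "x (j+1) = x j + frac \<alpha> - of_bool (x (j+1) < x j)" for j
  proof -
    have "x (j+1) = frac ((real j * \<alpha> + \<beta>) + \<alpha>)" by (simp add: x_def algebra_simps)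
    then show ?thesis using frac_add[of "real j * \<alpha> + \<beta>" \<alpha>] frac_lt_1[of \<alpha>]
      by (auto simp: x_def[symmetric] frac_not_neg)
  qed
  have x01: "0 \<le> x j" "x j < 1" for j by (auto simp: x_def frac_lt_1)
  have lt: "\<theta> (j+1) < \<theta> j \<longleftrightarrow> x (j+1) < x j" if "j \<in> {1..m-1}" for j
    using le[OF consecutive_in_range[OF that]] by linarith
  \<comment> \<open>Both points advance by \<open>frac \<alpha>\<close>. Their order survives if
    both or neither wrap around; if only one wraps, it was the higher point and becomes the lower
    one.\<close>
  have cmp: "of_bool (\<theta> (j+1) \<le> \<theta> (i+1)) =
      of_bool (\<theta> j \<le> \<theta> i) + of_bool (\<theta> (j+1) < \<theta> j) - (of_bool (\<theta> (i+1) < \<theta> i) :: int)"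
    if j: "j \<in> {1..m-1}" for j
  proof -
    note ri = consecutive_in_range[OF i] and rj = consecutive_in_range[OF j]
    show ?thesis
      unfolding le[OF rj(1) ri(1)] le[OF rj(2) ri(2)] lt[OF i] lt[OF j]
      using step[of i] step[of j] x01[of i] x01[of j] x01[of "i+1"] x01[of "j+1"]
      by (cases "x (j+1) < x j"; cases "x (i+1) < x i"; simp only: of_bool_eq; simp add: of_bool_def)
  qed
  obtain n where n: "m = Suc n" "1 \<le> n" using i by (cases m) auto
  have im: "\<theta> i \<le> m" "\<theta> (i+1) \<le> m" using S(9)[of i] S(9)[of "i+1"] i by auto
  have "int (\<theta> (i+1)) - of_bool (\<theta> 1 \<le> \<theta> (i+1)) = (\<Sum>j=1..m-1. of_bool (\<theta> (j+1) \<le> \<theta> (i+1)))"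
    unfolding sum_of_bool_rank[OF \<theta> im(2), symmetric] n
    by (subst sum.atLeast_Suc_atMost) (simp_all only: sum.shift_bounds_cl_Suc_ivl, simp_all)
  also have "\<dots> = (\<Sum>j=1..m-1. of_bool (\<theta> j \<le> \<theta> i)) + (\<Sum>j=1..m-1. of_bool (\<theta> (j+1) < \<theta> j))
       - (int m - 1) * of_bool (\<theta> (i+1) < \<theta> i)"
    using n by (simp only: sum.cong[OF refl cmp] sum.distrib sum_subtractf) (simp add: algebra_simps)
  also have "(\<Sum>j=1..m-1. of_bool (\<theta> j \<le> \<theta> i)) = int (\<theta> i) - of_bool (\<theta> m \<le> \<theta> i)"
    unfolding sum_of_bool_rank[OF \<theta> im(1), symmetric] n by simp
  finally show ?thesis by simp
qed

text \<open>By \<open>rotation_step\<close>, \<open>Delta\<close> has the same value at every index,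
  namely the number of wrap-arounds minus \<open>m - 1\<close>.\<close>

lemma sos_type_inv_subset_Y: "2 \<le> m \<Longrightarrow> sos_type_inv m \<subseteq> Y_set m"
proof
  fix \<theta> assume m: "2 \<le> m" and "\<theta> \<in> sos_type_inv m"
  then obtain \<alpha> \<beta> where \<theta>: "\<theta> \<in> Sym m" and
    ord: "\<And>i j. i \<in> {1..m} \<Longrightarrow> j \<in> {1..m} \<Longrightarrow>
      \<theta> i < \<theta> j \<Longrightarrow> frac (real i * \<alpha> + \<beta>) < frac (real j * \<alpha> + \<beta>)"
    using sos_type_inv_iff[OF le_trans[OF one_le_numeral m], of \<theta>] by blast
  have "Delta m \<theta> i = (\<Sum>j=1..m-1. of_bool (\<theta> (j+1) < \<theta> j)) - (int m - 1)" if "i \<in> {1..m-1}" for i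
    using rotation_step[OF \<theta> that, of \<alpha> \<beta>] ord unfolding Delta_def
    by (cases "\<theta> (i+1) < \<theta> i") (auto simp: not_less)
  then show "\<theta> \<in> Y_set m" using \<theta> by (auto simp: Y_set_def)
qed

section \<open>Rotations that start at the origin\<close>

text \<open>For \<beta> = 0 the wrap-arounds are visible from \<open>\<theta> 1\<close> alone, which
  eliminates from \<open>rotation_step\<close> both the comparison with \<open>\<theta> 1\<close>
  and the number of wrap-arounds.\<close>

lemma sos_inv_subset_W:
  assumes m: "2 \<le> m"
  shows "sos_inv m \<subseteq> W_set m"
proof
  fix \<theta> assume "\<theta> \<in> sos_inv m"
  then obtain \<alpha> where \<theta>: "\<theta> \<in> Sym m" and
    pos: "\<And>i. i \<in> {1..m} \<Longrightarrow> 0 < frac (real i * \<alpha>)" and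
    ord: "\<And>i j. i \<in> {1..m} \<Longrightarrow> j \<in> {1..m} \<Longrightarrow>
      \<theta> i < \<theta> j \<Longrightarrow> frac (real i * \<alpha>) < frac (real j * \<alpha>)"
    using m by (elim sos_invE) auto
  note S = Sym_facts[OF \<theta>]
  let ?W = "(\<Sum>j=1..m-1. of_bool (\<theta> (j+1) < \<theta> j)) :: int"
  \<comment> \<open>The first point is \<open>frac \<alpha>\<close> itself. A step that wraps lands
    below it, and one that does not lands above it because the previous point is positive.\<close>
  have wrap: "\<theta> (j+1) < \<theta> j \<longleftrightarrow> \<theta> (j+1) < \<theta> 1" if j: "j \<in> {1..m-1}" for j
  proof -
    have *: "\<theta> p < \<theta> q \<longleftrightarrow> frac (real p * \<alpha>) < frac (real q * \<alpha>)"
      if "p \<in> {1..m}" "q \<in> {1..m}" for p q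
      using ord[OF that] ord[OF that(2,1)] S(11)[of p q]
      by (metis linorder_neqE_nat less_asym order_less_irrefl)
    have "frac (real (j+1) * \<alpha>) = frac (real j * \<alpha> + \<alpha>)" by (simp add: algebra_simps)
    then show ?thesis
      using *[of "j+1" j] *[of "j+1" 1] j m frac_add[of "real j * \<alpha>" \<alpha>] frac_lt_1[of \<alpha>]
        pos[of 1] pos[of j] frac_lt_1[of "real j * \<alpha>"]
      by (auto simp: frac_not_neg split: if_splits)
  qed
  have t1: "\<theta> 1 \<in> {1..m}" using S(9)[of 1] m by auto
  \<comment> \<open>The rank of the first point counts that point and the points below it; by
    \<open>wrap\<close> there is one of the latter for each wrap-around.\<close>
  have W: "int (\<theta> 1) = 1 + ?W"
  proof -
    obtain n where n: "m = Suc n" "1 \<le> n" using m by (cases m) auto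
    have "int (\<theta> 1) = 1 + (\<Sum>j=1..m-1. of_bool (\<theta> (j+1) \<le> \<theta> 1))"
      using t1 by (subst sum_of_bool_rank[OF \<theta>, of "\<theta> 1", symmetric], simp)
        (simp only: n, subst sum.atLeast_Suc_atMost, simp, simp only: sum.shift_bounds_cl_Suc_ivl, simp)
    also have "(\<Sum>j=1..m-1. of_bool (\<theta> (j+1) \<le> \<theta> 1)) = ?W"
    proof (rule sum.cong[OF refl])
      fix j assume j: "j \<in> {1..m-1}"
      have "\<theta> (j+1) \<noteq> \<theta> 1" using S(11)[of "j+1" 1] j by simp
      then show "of_bool (\<theta> (j+1) \<le> \<theta> 1) = (of_bool (\<theta> (j+1) < \<theta> j) :: int)"
        using wrap[OF j] by (simp add: le_less)
    qed
    finally show ?thesis .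
  qed
  show "\<theta> \<in> W_set m"
    unfolding W_set_def
  proof (intro CollectI conjI ballI \<theta>)
    fix i assume i: "i \<in> {1..m-1}"
    show "int (\<theta> (i+1)) - int (\<theta> i) =
       int (\<theta> 1) - of_bool (\<theta> m \<le> \<theta> i) + int m * (of_bool (\<theta> i \<le> \<theta> (i+1)) - 1)"
      using rotation_step[OF \<theta> i, of \<alpha> 0] ord wrap[OF i] W
      by (cases "\<theta> (i+1) < \<theta> i") (auto simp: not_less)
  qed
qed

section \<open>From congruences to integer identities\<close>

text \<open>Adding \<open>m\<close> at descents moves the difference of consecutive values into
  \<open>{1..m-1}\<close>. The other side lies in \<open>{0..m}\<close>, and \<open>m\<close> is
  excluded because it would make the difference divisible by \<open>m\<close>; so congruent numbers
  are equal.\<close>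

lemma V_eq_W: "V_set m = W_set m"
proof (intro set_eqI iffI)
  fix \<theta> assume "\<theta> \<in> W_set m"
  then show "\<theta> \<in> V_set m" by (auto simp: W_set_def V_set_def cong_iff_lin)
next
  fix \<theta> assume V: "\<theta> \<in> V_set m"
  then have \<theta>: "\<theta> \<in> Sym m" by (simp add: V_set_def)
  note S = Sym_facts[OF \<theta>]
  have "int (\<theta> (i+1)) - int (\<theta> i) =
       int (\<theta> 1) - of_bool (\<theta> m \<le> \<theta> i) + int m * (of_bool (\<theta> i \<le> \<theta> (i+1)) - 1)" if i: "i \<in> {1..m-1}" for i
  proof -
    define r where "r = int (\<theta> 1) - of_bool (\<theta> m \<le> \<theta> i)"
    define d where "d = int (\<theta> (i+1)) - int (\<theta> i) + int m * (1 - of_bool (\<theta> i \<le> \<theta> (i+1)))"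
    have "\<theta> 1 \<in> {1..m}" using i by (intro S(9)) auto
    then have r: "0 \<le> r" "r \<le> int m" by (auto simp: r_def)
    have d: "1 \<le> d" "d < int m"
      using S(9)[OF consecutive_in_range(1)[OF i]] S(9)[OF consecutive_in_range(2)[OF i]] S(11)[of i "i+1"]
      by (auto simp: d_def)
    have "[int (\<theta> (i+1)) - int (\<theta> i) = r] (mod int m)" using V i by (simp add: V_set_def r_def)
    moreover have "[d = int (\<theta> (i+1)) - int (\<theta> i)] (mod int m)"
      by (auto simp: d_def cong_def)
    ultimately have c: "d mod int m = r mod int m" unfolding cong_def by simp
    have "r < int m"
    proof (rule ccontr)
      assume "\<not> r < int m"
      then have "r = int m" using r by simp
      then show False using c d by simp
    qed
    then have "d = r" using c d r by simp
    then show ?thesis by (simp add: d_def r_def algebra_simps)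
  qed
  then show "\<theta> \<in> W_set m" using \<theta> by (simp add: W_set_def)
qed

section \<open>Shifts of ranks as rotations of the circle\<close>

text \<open>Adding \<open>k\<close> to the ranks modulo \<open>m\<close> makes the top
  \<open>k\<close> points the lowest ones. Moving the origin to a cut \<open>s\<close> just below
  these points has the same effect, so \<beta> = -s works.\<close>

lemma shift_closure_sos_inv_subset:
  assumes m: "2 \<le> m"
  shows "shift_closure m (sos_inv m) \<subseteq> sos_type_inv m"
proof
  fix \<theta>' assume "\<theta>' \<in> shift_closure m (sos_inv m)"
  then obtain \<theta> k where \<theta>': "\<theta>' \<in> Sym m" and so: "\<theta> \<in> sos_inv m" and k: "k \<in> {1..m}"
    and cg: "\<And>i. i \<in> {1..m} \<Longrightarrow> [\<theta>' i = \<theta> i + k] (mod m)"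
    unfolding shift_closure_def shift_equiv_def by blast
  from so m obtain \<alpha> where \<theta>: "\<theta> \<in> Sym m" and
    pos: "\<And>i. i \<in> {1..m} \<Longrightarrow> 0 < frac (real i * \<alpha>)" and
    ord: "\<And>i j. i \<in> {1..m} \<Longrightarrow> j \<in> {1..m} \<Longrightarrow>
      \<theta> i < \<theta> j \<Longrightarrow> frac (real i * \<alpha>) < frac (real j * \<alpha>)"
    by (elim sos_invE) auto
  note S = Sym_facts[OF \<theta>] and S' = Sym_facts[OF \<theta>']
  define x where "x i = frac (real i * \<alpha>)" for i
  have x0: "0 < x i" if "i \<in> {1..m}" for i using pos[OF that] by (simp only: x_def)
  have x1: "x i < 1" for i by (simp add: x_def frac_lt_1)
  have xord: "x i < x j" if "i \<in> {1..m}" "j \<in> {1..m}" "\<theta> i < \<theta> j" for i j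
    using ord[OF that] by (simp only: x_def)
  have shift: "\<theta>' i = (if \<theta> i \<le> m - k then \<theta> i + k else \<theta> i + k - m)" if i: "i \<in> {1..m}" for i
  proof -
    define y where "y = (if \<theta> i \<le> m - k then \<theta> i + k else \<theta> i + k - m)"
    have y: "1 \<le> y" "y \<le> m" using S(9)[OF i] k by (auto simp: y_def)
    have "(\<theta> i + k) mod m = y mod m"
      using k by (auto simp: y_def le_mod_geq)
    then have "\<theta>' i mod m = y mod m" using cg[OF i] unfolding cong_def by simp
    moreover have "1 \<le> \<theta>' i" "\<theta>' i \<le> m" using S'(9)[OF i] by auto
    ultimately have "\<theta>' i = y" using y by (metis le_neq_implies_less mod_less mod_self not_one_le_zero)
    then show ?thesis by (simp add: y_def)
  qed
  obtain s where s: "0 \<le> s" "s < 1"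
    and low: "\<And>i. i \<in> {1..m} \<Longrightarrow> \<theta> i \<le> m - k \<Longrightarrow> x i < s"
    and high: "\<And>i. i \<in> {1..m} \<Longrightarrow> \<not> \<theta> i \<le> m - k \<Longrightarrow> s < x i"
  proof (cases "k = m")
    case True
    have "\<not> \<theta> i \<le> m - k" if "i \<in> {1..m}" for i
      using S(9)[OF that] True by auto
    \<comment> \<open>A shift by \<open>m\<close> fixes every rank: no point has to lie below the
      cut, and all points are positive.\<close>
    then show ?thesis using that[of 0] x0 by simp
  next
    case False
    define p q where "p = inv \<theta> (m - k)" and "q = inv \<theta> (m - k + 1)"
    have "m - k \<in> {1..m}" "m - k + 1 \<in> {1..m}" using k False by auto
    then have p: "p \<in> {1..m}" "\<theta> p = m - k" and q: "q \<in> {1..m}" "\<theta> q = m - k + 1"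
      using S(6) S(10) by (auto simp only: p_def q_def)
    have pq: "x p < x q" using xord[OF p(1) q(1)] p q by simp
    \<comment> \<open>The cut is the midpoint between the points of ranks \<open>m - k\<close> and
      \<open>m - k + 1\<close>.\<close>
    show ?thesis
    proof (rule that[of "(x p + x q) / 2"])
      show "0 \<le> (x p + x q) / 2" "(x p + x q) / 2 < 1"
        using x0[OF p(1)] x0[OF q(1)] x1[of p] x1[of q] by simp_all
      fix i assume i: "i \<in> {1..m}"
      show "x i < (x p + x q) / 2" if "\<theta> i \<le> m - k"
      proof -
        have "x i \<le> x p" using xord[OF i p(1)] p that S(11)[of i p] by (cases "i = p") auto
        then show ?thesis using pq by simp
      qed
      show "(x p + x q) / 2 < x i" if "\<not> \<theta> i \<le> m - k"
      proof -
        have "x q \<le> x i" using xord[OF q(1) i] q that S(11)[of i q] by (cases "i = q") auto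
        then show ?thesis using pq by simp
      qed
    qed
  qed
  define y where "y i = frac (real i * \<alpha> + - s)" for i
  have y: "y i = (if \<theta> i \<le> m - k then x i - s + 1 else x i - s)" if i: "i \<in> {1..m}" for i
  proof -
    have x: "real i * \<alpha> = x i + of_int \<lfloor>real i * \<alpha>\<rfloor>" by (simp add: x_def frac_def)
    have "real i * \<alpha> + - s - (x i - s) = of_int \<lfloor>real i * \<alpha>\<rfloor>"
      "real i * \<alpha> + - s - (x i - s + 1) = of_int (\<lfloor>real i * \<alpha>\<rfloor> - 1)"
      by (subst x, simp)+
    then show ?thesis
      unfolding y_def frac_unique_iff using s low[OF i] high[OF i] x0[OF i] x1[of i]
      by (cases "\<theta> i \<le> m - k") (simp_all only: Ints_of_int if_True if_False, auto)
  qed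
  have "0 < y i" if i: "i \<in> {1..m}" for i
    using y[OF i] high[OF i] s(2) x0[OF i] by (cases "\<theta> i \<le> m - k") auto
  moreover have "y i < y j"
    if i: "i \<in> {1..m}" and j: "j \<in> {1..m}" and ij: "\<theta>' i < \<theta>' j" for i j
  proof -
    consider "\<theta> i \<le> m - k \<longleftrightarrow> \<theta> j \<le> m - k" | "\<theta> i \<le> m - k" "\<not> \<theta> j \<le> m - k"
      | "\<not> \<theta> i \<le> m - k" "\<theta> j \<le> m - k" by blast
    then show ?thesis
    proof cases
      case 1
      then have "\<theta> i < \<theta> j" using ij k unfolding shift[OF i] shift[OF j] by (auto split: if_splits)
      then show ?thesis using xord[OF i j] 1 unfolding y[OF i] y[OF j] by simp
    next
      \<comment> \<open>Only the point of \<open>j\<close> is above the cut, so the shift puts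
        \<open>j\<close> before \<open>i\<close>, contrary to \<open>ij\<close>.\<close>
      case 2
      then show ?thesis using ij k S(9)[OF i] S(9)[OF j] unfolding shift[OF i] shift[OF j] by auto
    next
      case 3
      then show ?thesis using x0[OF j] x1[of i] unfolding y[OF i] y[OF j] by simp
    qed
  qed
  ultimately show "\<theta>' \<in> sos_type_inv m"
    unfolding y_def sos_type_inv_iff[OF le_trans[OF one_le_numeral m]] using \<theta>' by blast
qed

subsection \<open>Cutting the circle: \<open>Y_set\<close> and the shift closure of \<open>V_set\<close>\<close>

text \<open>This is the congruence defining \<open>V_set\<close>, written for the ranks renumbered
  cyclically from \<open>K + 1\<close> on. The case distinction says that, in this cyclic order,
  \<open>\<theta> i\<close> does not come before \<open>\<theta> m\<close>.\<close>

lemma Y_set_cut: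
  assumes m: "2 \<le> m" and Y: "\<theta> \<in> Y_set m"
  obtains K where "0 \<le> K" "K \<le> int m"
    "\<And>i. i \<in> {1..m-1} \<Longrightarrow> [int (\<theta> (i+1)) - int (\<theta> i) = int (\<theta> 1) - K -
       of_bool (if int (\<theta> m) \<le> K then \<theta> m \<le> \<theta> i \<and> int (\<theta> i) \<le> K
                else \<theta> m \<le> \<theta> i \<or> int (\<theta> i) \<le> K)] (mod int m)"
proof -
  note cut = that
  have \<theta>: "\<theta> \<in> Sym m" using Y by (auto simp: Y_set_def split: if_splits)
  note S = Sym_facts[OF \<theta>]
  \<comment> \<open>Normalised so that \<open>W\<close> corresponds to the number of wrap-arounds in
    \<open>rotation_step\<close>.\<close>
  define W where "W = Delta m \<theta> 1 + int m - 1"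
  have const: "Delta m \<theta> i = W - int m + 1" if "1 \<le> i" "i \<le> m - 1" for i
    using that
  proof (induction i rule: nat_induct_at_least)
    case (Suc i)
    then have "i \<in> {1..m-2}" by auto
    then have "Delta m \<theta> (i+1) - Delta m \<theta> i = 0" using Y m by (cases "m = 2") (auto simp: Y_set_def)
    then show ?case using Suc by simp
  qed (simp add: W_def)
  define a b where "a = int (\<theta> 1)" and "b = int (\<theta> m)"
  have "\<theta> 1 \<in> {1..m}" "\<theta> m \<in> {1..m}" using m by (intro S(9), simp)+
  then have ab: "1 \<le> a" "a \<le> int m" "1 \<le> b" "b \<le> int m" by (auto simp: a_def b_def)
  have step: "int (\<theta> (i+1)) - int (\<theta> i) = W - (int m - 1) - of_bool (b \<le> int (\<theta> i))
      + of_bool (a \<le> int (\<theta> (i+1))) + (int m - 1) * of_bool (\<theta> i < \<theta> (i+1))"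
    and range: "1 \<le> int (\<theta> i)" "int (\<theta> i) \<le> int m" "1 \<le> int (\<theta> (i+1))" "int (\<theta> (i+1)) \<le> int m"
      "int (\<theta> i) \<noteq> b" "int (\<theta> (i+1)) \<noteq> a" "int (\<theta> i) \<noteq> int (\<theta> (i+1))"
    if i: "i \<in> {1..m-1}" for i
  proof -
    show d: "int (\<theta> i) \<noteq> int (\<theta> (i+1))" using S(11)[of i "i+1"] by auto
    show "int (\<theta> i) \<noteq> b" "int (\<theta> (i+1)) \<noteq> a" using S(11)[of i m] S(11)[of "i+1" 1] i
      by (auto simp: a_def b_def)
    show "1 \<le> int (\<theta> i)" "int (\<theta> i) \<le> int m" "1 \<le> int (\<theta> (i+1))" "int (\<theta> (i+1)) \<le> int m"
      using S(9)[OF consecutive_in_range(1)[OF i]] S(9)[OF consecutive_in_range(2)[OF i]] by auto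
    show "int (\<theta> (i+1)) - int (\<theta> i) = W - (int m - 1) - of_bool (b \<le> int (\<theta> i))
      + of_bool (a \<le> int (\<theta> (i+1))) + (int m - 1) * of_bool (\<theta> i < \<theta> (i+1))"
      using const[of i] i d unfolding Delta_def a_def b_def by (auto simp: le_less)
  qed
  have one: "1 \<in> {1..m-1}" using m by simp
  \<comment> \<open>With \<open>b\<close> and \<open>a\<close> removed, the ranks of
    \<open>\<theta> 1\<close> and \<open>\<theta> 2\<close> lie in \<open>{1..m-1}\<close>; an
    ascent does not lower this rank and a descent does not raise it. So the first step already
    bounds \<open>W\<close>.\<close>
  have W: "0 \<le> W" "W \<le> int m - 1"
    using step[OF one] range[OF one] ab by (auto simp: of_bool_def split: if_splits)
  \<comment> \<open>An exact identity up to a multiple of \<open>m\<close> suffices. Below,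
    \<open>c\<close> is -1 if the cut falls in range directly and 0 if \<open>m\<close> has to be
    added to it.\<close>
  have *: thesis if "0 \<le> K" "K \<le> int m"
    "\<And>i. i \<in> {1..m-1} \<Longrightarrow> int (\<theta> (i+1)) - int (\<theta> i) = a - K -
       of_bool (if b \<le> K then b \<le> int (\<theta> i) \<and> int (\<theta> i) \<le> K
                else b \<le> int (\<theta> i) \<or> int (\<theta> i) \<le> K) + int m * (of_bool (\<theta> i < \<theta> (i+1)) + c)" for K c
    using that(1,2)
  proof (rule cut)
    fix i assume "i \<in> {1..m-1}"
    from that(3)[OF this] show "[int (\<theta> (i+1)) - int (\<theta> i) = int (\<theta> 1) - K -
       of_bool (if int (\<theta> m) \<le> K then \<theta> m \<le> \<theta> i \<and> int (\<theta> i) \<le> K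
                else \<theta> m \<le> \<theta> i \<or> int (\<theta> i) \<le> K)] (mod int m)"
      unfolding a_def b_def by (simp add: cong_def)
  qed
  \<comment> \<open>On the ranks in \<open>{1..m} - {b}\<close> and \<open>{1..m} - {a}\<close>, the map \<open>\<theta> i \<mapsto> \<theta> (i+1)\<close> is the rotation
    by \<open>W\<close> modulo \<open>m - 1\<close>; \<open>\<theta> i\<close> is an ascent exactly if its rank is at most \<open>m - 1 - W\<close>. The cut is
    at \<open>a - W - 1\<close> modulo \<open>m\<close>, up to one unit depending on the side of \<open>b\<close> on which it falls.\<close>
  define k where "k = a - W - 1"
  consider "0 \<le> k" "k < b" | "0 \<le> k" "b \<le> k" | "k < 0" "b \<le> k + int m" | "k < 0" "k + int m < b"
    by linarith
  then show thesis
  proof cases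
    case 1
    show thesis
    proof (rule *[of k "-1"])
      fix i assume "i \<in> {1..m-1}"
      from step[OF this] range[OF this] 1 W ab
      show "int (\<theta> (i+1)) - int (\<theta> i) = a - k -
       of_bool (if b \<le> k then b \<le> int (\<theta> i) \<and> int (\<theta> i) \<le> k
                else b \<le> int (\<theta> i) \<or> int (\<theta> i) \<le> k) + int m * (of_bool (\<theta> i < \<theta> (i+1)) + -1)"
        unfolding k_def by (auto simp: of_bool_def not_less not_le algebra_simps split: if_splits)
    qed (use 1 W ab in \<open>auto simp: k_def\<close>)
  next
    case 2
    show thesis
    proof (rule *[of "k+1" "-1"])
      fix i assume "i \<in> {1..m-1}"
      from step[OF this] range[OF this] 2 W ab
      show "int (\<theta> (i+1)) - int (\<theta> i) = a - (k+1) -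
       of_bool (if b \<le> k+1 then b \<le> int (\<theta> i) \<and> int (\<theta> i) \<le> k+1
                else b \<le> int (\<theta> i) \<or> int (\<theta> i) \<le> k+1) + int m * (of_bool (\<theta> i < \<theta> (i+1)) + -1)"
        unfolding k_def by (auto simp: of_bool_def not_less not_le algebra_simps split: if_splits)
    qed (use 2 W ab in \<open>auto simp: k_def\<close>)
  next
    case 3
    show thesis
    proof (rule *[of "k + int m" 0])
      fix i assume "i \<in> {1..m-1}"
      from step[OF this] range[OF this] 3 W ab
      show "int (\<theta> (i+1)) - int (\<theta> i) = a - (k + int m) -
       of_bool (if b \<le> k + int m then b \<le> int (\<theta> i) \<and> int (\<theta> i) \<le> k + int m
                else b \<le> int (\<theta> i) \<or> int (\<theta> i) \<le> k + int m) + int m * (of_bool (\<theta> i < \<theta> (i+1)) + 0)"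
        unfolding k_def by (auto simp: of_bool_def not_less not_le algebra_simps split: if_splits)
    qed (use 3 W ab in \<open>auto simp: k_def\<close>)
  next
    case 4
    show thesis
    proof (rule *[of "k + int m - 1" 0])
      fix i assume "i \<in> {1..m-1}"
      from step[OF this] range[OF this] 4 W ab
      show "int (\<theta> (i+1)) - int (\<theta> i) = a - (k + int m - 1) -
       of_bool (if b \<le> k + int m - 1 then b \<le> int (\<theta> i) \<and> int (\<theta> i) \<le> k + int m - 1
                else b \<le> int (\<theta> i) \<or> int (\<theta> i) \<le> k + int m - 1) + int m * (of_bool (\<theta> i < \<theta> (i+1)) + 0)"
        unfolding k_def by (auto simp: of_bool_def not_less not_le algebra_simps split: if_splits)
    qed (use 4 W ab in \<open>auto simp: k_def\<close>)
  qed
qed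

text \<open>Renumbering the values cyclically from the cut gives a member of \<open>V_set\<close>,
  and shifting back by \<open>K\<close> recovers \<theta>.\<close>

lemma Y_subset_shift_closure_V:
  assumes m: "2 \<le> m"
  shows "Y_set m \<subseteq> shift_closure m (V_set m)"
proof
  fix \<theta> assume Y: "\<theta> \<in> Y_set m"
  then have \<theta>: "\<theta> \<in> Sym m" by (auto simp: Y_set_def split: if_splits)
  note S = Sym_facts[OF \<theta>]
  obtain K' where K': "0 \<le> K'" "K' \<le> int m"
    and cut': "\<And>i. i \<in> {1..m-1} \<Longrightarrow> [int (\<theta> (i+1)) - int (\<theta> i) = int (\<theta> 1) - K' -
       of_bool (if int (\<theta> m) \<le> K' then \<theta> m \<le> \<theta> i \<and> int (\<theta> i) \<le> K'
                else \<theta> m \<le> \<theta> i \<or> int (\<theta> i) \<le> K')] (mod int m)"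
    using Y_set_cut[OF m Y] by blast
  obtain K where KK: "K' = int K" using K'(1) nonneg_int_cases by blast
  have K: "K \<le> m" using K' KK by simp
  define \<theta>' where "\<theta>' i = (if i \<in> {1..m} then if K < \<theta> i then \<theta> i - K else \<theta> i + m - K else i)" for i
  have \<theta>'_eq: "int (\<theta>' i) = int (\<theta> i) - int K + int m * of_bool (\<theta> i \<le> K)" if "i \<in> {1..m}" for i
    unfolding \<theta>'_def using that K by auto
  have "inj_on \<theta>' {1..m}"
  proof (rule inj_onI)
    fix i j assume i: "i \<in> {1..m}" and j: "j \<in> {1..m}" and eq: "\<theta>' i = \<theta>' j"
    have "int (\<theta>' i) = int (\<theta>' j)" using eq by simp
    then have "\<theta> i = \<theta> j"
      unfolding \<theta>'_eq[OF i] \<theta>'_eq[OF j] using S(9)[OF i] S(9)[OF j] by (auto simp: of_bool_def split: if_splits)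
    then show "i = j" using S(11) by simp
  qed
  moreover have "\<theta>' i \<in> {1..m}" if "i \<in> {1..m}" for i
    unfolding \<theta>'_def using that S(9)[OF that] K by auto
  ultimately have "bij_betw \<theta>' {1..m} {1..m}"
    by (intro bij_betw_imageI endo_inj_surj) auto
  then have \<theta>': "\<theta>' \<in> Sym m"
    unfolding Sym_def by (auto intro!: bij_imp_permutes simp: \<theta>'_def)
  have mm: "m \<in> {1..m}" "1 \<in> {1..m}" using m by auto
  have "[int (\<theta>' (i+1)) - int (\<theta>' i) = int (\<theta>' 1) - of_bool (\<theta>' m \<le> \<theta>' i)] (mod int m)"
    if i: "i \<in> {1..m-1}" for i
  proof -
    note r = consecutive_in_range[OF i]
    have le: "\<theta>' m \<le> \<theta>' i \<longleftrightarrow> (if int (\<theta> m) \<le> K' then \<theta> m \<le> \<theta> i \<and> int (\<theta> i) \<le> K'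
                else \<theta> m \<le> \<theta> i \<or> int (\<theta> i) \<le> K')"
      unfolding KK \<theta>'_def using mm r S(9)[OF mm(1)] S(9)[OF r(1)] K by auto
    have c: "[int (\<theta>' j) = int (\<theta> j) - K'] (mod int m)" if "j \<in> {1..m}" for j
      unfolding \<theta>'_eq[OF that] KK by (simp add: cong_def)
    have "[int (\<theta>' (i+1)) - int (\<theta>' i) = (int (\<theta> (i+1)) - K') - (int (\<theta> i) - K')] (mod int m)"
      by (intro cong_diff c r)
    also have "(int (\<theta> (i+1)) - K') - (int (\<theta> i) - K') = int (\<theta> (i+1)) - int (\<theta> i)" by simp
    also note cut'[OF i]
    also have "[int (\<theta> 1) - K' - of_bool (if int (\<theta> m) \<le> K' then \<theta> m \<le> \<theta> i \<and> int (\<theta> i) \<le> K'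
                else \<theta> m \<le> \<theta> i \<or> int (\<theta> i) \<le> K') = int (\<theta>' 1) - of_bool (\<theta>' m \<le> \<theta>' i)] (mod int m)"
      unfolding le by (intro cong_diff cong_sym[OF c] mm cong_refl)
    finally show ?thesis .
  qed
  then have "\<theta>' \<in> V_set m" using \<theta>' by (simp add: V_set_def)
  moreover have "shift_equiv m \<theta>' \<theta>"
    unfolding shift_equiv_def
  proof (intro bexI ballI)
    \<comment> \<open>Shift amounts are taken from \<open>{1..m}\<close>, so the trivial shift is
      represented by \<open>m\<close>.\<close>
    show "(if K = 0 then m else K) \<in> {1..m}" using K m by auto
    fix i assume i: "i \<in> {1..m}"
    show "[\<theta> i = \<theta>' i + (if K = 0 then m else K)] (mod m)"
      using i K S(9)[OF i] by (auto simp: \<theta>'_def cong_def)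
  qed
  ultimately show "\<theta> \<in> shift_closure m (V_set m)" using \<theta> by (auto simp: shift_closure_def)
qed

subsection \<open>Gaps: members of \<open>W_set\<close> are inverse Sos permutations\<close>

text \<open>The candidate for the integer part of \<open>i * \<alpha>\<close>, read off from
  \<theta> alone. For \<open>\<theta> \<in> Sym m\<close> the term \<open>j = 0\<close> vanishes,
  since \<open>\<theta> 0 = 0\<close>.\<close>

definition descents :: "(nat \<Rightarrow> nat) \<Rightarrow> nat \<Rightarrow> int" where
  "descents \<theta> i = (\<Sum>j<i. of_bool (\<theta> (j+1) < \<theta> j))"

text \<open>The position that \<open>frac (i * \<alpha>)\<close> must have on the line, for \<open>i = inv \<theta> x\<close>, if
  \<open>\<theta>\<close> sorts these numbers; the end point \<open>1\<close> plays the role of rank \<open>m + 1\<close>.\<close>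

definition height :: "nat \<Rightarrow> (nat \<Rightarrow> nat) \<Rightarrow> real \<Rightarrow> nat \<Rightarrow> real" where
  "height m \<theta> \<alpha> x =
    (if x = m + 1 then 1 else real (inv \<theta> x) * \<alpha> - of_int (descents \<theta> (inv \<theta> x)))"

text \<open>The slope \<alpha> comes last so that gaps can be compared as functions, before \<alpha>
  is chosen.\<close>

definition gap :: "nat \<Rightarrow> (nat \<Rightarrow> nat) \<Rightarrow> nat \<Rightarrow> real \<Rightarrow> real" where
  "gap m \<theta> x \<alpha> = height m \<theta> \<alpha> (x+1) - height m \<theta> \<alpha> x"

text \<open>Index 0 joins the recursion as the origin, with rank 0: there both indicators vanish.
  This gives every index in \<open>{1..m}\<close> a predecessor.\<close>

lemma W_set_step:
  assumes "\<theta> \<in> W_set m" "i < m"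
  shows "int (\<theta> (i+1)) = int (\<theta> i) + int (\<theta> 1) - of_bool (\<theta> m \<le> \<theta> i) - int m * of_bool (\<theta> (i+1) < \<theta> i)"
proof -
  have \<theta>: "\<theta> \<in> Sym m" using assms(1) by (simp add: W_set_def)
  show ?thesis
  proof (cases "i = 0")
    case True
    have "\<theta> m \<in> {1..m}" using assms(2) by (intro Sym_facts(9)[OF \<theta>]) simp
    then show ?thesis using True by (simp add: Sym_facts(7)[OF \<theta>])
  next
    case False
    then have "i \<in> {1..m-1}" using assms(2) by auto
    then have "int (\<theta> (i+1)) - int (\<theta> i) =
       int (\<theta> 1) - of_bool (\<theta> m \<le> \<theta> i) + int m * (of_bool (\<theta> i \<le> \<theta> (i+1)) - 1)"
      using assms(1) unfolding W_set_def by blast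
    then show ?thesis by (cases "\<theta> (i+1) < \<theta> i") (simp_all add: not_less)
  qed
qed

lemma Sym_le: "\<theta> i \<le> m" if "\<theta> \<in> Sym m" "i \<le> m"
  using Sym_facts(7)[OF that(1)] Sym_facts(9)[OF that(1), of i] that(2) by (cases "i = 0") auto

lemma height_step:
  assumes "\<theta> \<in> Sym m" "i < m"
  shows "height m \<theta> \<alpha> (\<theta> (i+1)) = height m \<theta> \<alpha> (\<theta> i) + \<alpha> - of_bool (\<theta> (i+1) < \<theta> i)"
proof -
  note S = Sym_facts[OF assms(1)]
  have "\<theta> i \<noteq> m + 1" "\<theta> (i+1) \<noteq> m + 1"
    using Sym_le[OF assms(1), of i] Sym_le[OF assms(1), of "i+1"] assms(2) by simp_all
  then show ?thesis by (simp add: height_def S(5) descents_def algebra_simps)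
qed

text \<open>Both end points of a gap have predecessors; these again bound a gap unless the
  removed value \<open>\<theta> m\<close> lies between them.\<close>

lemma gap_predecessor:
  assumes W: "\<theta> \<in> W_set m" and y: "y \<in> {1..m-1}"
  obtains x where "x \<le> m" "x = m \<or> inv \<theta> x < inv \<theta> y" "gap m \<theta> y = gap m \<theta> x"
  | "gap m \<theta> y = (\<lambda>\<alpha>. gap m \<theta> (\<theta> m - 1) \<alpha> + gap m \<theta> (\<theta> m) \<alpha>)"
proof -
  have \<theta>: "\<theta> \<in> Sym m" using W by (simp add: W_set_def)
  note S = Sym_facts[OF \<theta>]
  note r = consecutive_in_range[OF y]
  define i j where "i = inv \<theta> y - 1" and "j = inv \<theta> (y+1) - 1"
  have "inv \<theta> y \<in> {1..m}" "inv \<theta> (y+1) \<in> {1..m}" using S(10) r by blast+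
  then have i: "inv \<theta> y = i + 1" "i < m" and j: "inv \<theta> (y+1) = j + 1" "j < m"
    by (auto simp: i_def j_def)
  have ty: "\<theta> (i+1) = y" "\<theta> (j+1) = y + 1" unfolding i(1)[symmetric] j(1)[symmetric] by (simp_all only: S(6))
  define u v b where "u = \<theta> i" and "v = \<theta> j" and "b = \<theta> m"
  have le: "u \<le> m" "v \<le> m" using Sym_le[OF \<theta>] i(2) j(2) by (simp_all add: u_def v_def)
  have b: "1 \<le> b" "b \<le> m" using S(9)[of m] y by (auto simp: b_def)
  have ub: "u \<noteq> b" "v \<noteq> b" using S(11)[of i m] S(11)[of j m] i j by (auto simp: u_def v_def b_def)
  have u: "int y = int u + int (\<theta> 1) - of_bool (b \<le> u) - int m * of_bool (y < u)"
    and v: "int y + 1 = int v + int (\<theta> 1) - of_bool (b \<le> v) - int m * of_bool (y + 1 < v)"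
    using W_set_step[OF W i(2)] W_set_step[OF W j(2)] unfolding ty by (simp_all add: u_def v_def b_def)
  have hu: "height m \<theta> \<alpha> y = height m \<theta> \<alpha> u + \<alpha> - of_bool (y < u)"
    and hv: "height m \<theta> \<alpha> (y+1) = height m \<theta> \<alpha> v + \<alpha> - of_bool (y + 1 < v)" for \<alpha>
    using height_step[OF \<theta> i(2)] height_step[OF \<theta> j(2)] unfolding ty u_def v_def by auto
  have inv: "inv \<theta> u < inv \<theta> y" unfolding u_def S(5) i(1) by simp
  have h0: "height m \<theta> \<alpha> 0 = 0" for \<alpha> by (simp add: height_def S(8) descents_def)
  have h1: "height m \<theta> \<alpha> (m+1) = 1" for \<alpha> by (simp add: height_def)
  \<comment> \<open>Subtracting \<open>u\<close> from \<open>v\<close> gives these positions. If the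
    wraps agree, the predecessors are neighbours or have just \<open>b\<close> between them, as
    \<open>b\<close> belongs to index \<open>m\<close> and is no predecessor. If only the lower
    point wraps, the origin \<open>v = 0\<close> acts as the end point 1, with the same two
    possibilities.\<close>
  consider "y < u \<longleftrightarrow> y + 1 < v" "v = u + 1" | "y < u \<longleftrightarrow> y + 1 < v" "u + 1 = b" "v = b + 1"
    | "y < u" "\<not> y + 1 < v" "v = 0" "u = m" | "y < u" "\<not> y + 1 < v" "v = 0" "u + 1 = m" "b = m"
    using u v ub le b by (auto simp: of_bool_def split: if_splits)
  then show thesis
  proof cases
    case 1
    have "gap m \<theta> y \<alpha> = gap m \<theta> u \<alpha>" for \<alpha>
      unfolding gap_def hu hv using 1 by simp
    then have "gap m \<theta> y = gap m \<theta> u" ..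
    then show thesis using that(1)[of u] le inv by blast
  next
    case 2
    then have "u = b - 1" by simp
    then have "gap m \<theta> y \<alpha> = gap m \<theta> (b - 1) \<alpha> + gap m \<theta> b \<alpha>" for \<alpha>
      unfolding gap_def hu hv using 2 b by simp
    then have "gap m \<theta> y = (\<lambda>\<alpha>. gap m \<theta> (b - 1) \<alpha> + gap m \<theta> b \<alpha>)" ..
    then show thesis using that(2) by (simp add: b_def)
  next
    case 3
    have "gap m \<theta> y \<alpha> = gap m \<theta> m \<alpha>" for \<alpha>
      unfolding gap_def hu hv h1 using 3 h0[of \<alpha>] by simp
    then have "gap m \<theta> y = gap m \<theta> m" ..
    then show thesis using that(1)[of m] by blast
  next
    case 4
    then have "u = m - 1" by simp
    then have "gap m \<theta> y \<alpha> = gap m \<theta> (b - 1) \<alpha> + gap m \<theta> b \<alpha>" for \<alpha>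
      unfolding gap_def hu hv using 4 b h0[of \<alpha>] h1[of \<alpha>] by simp
    then have "gap m \<theta> y = (\<lambda>\<alpha>. gap m \<theta> (b - 1) \<alpha> + gap m \<theta> b \<alpha>)" ..
    then show thesis using that(2) by (simp add: b_def)
  qed
qed

section \<open>Propagation of gaps and their signs\<close>

text \<open>Passing to predecessors lowers the index of the lower end point, so it must stop: at an
  extreme gap or at the two gaps that meet in \<open>\<theta> m\<close>.\<close>

lemma gap_trichotomy:
  assumes W: "\<theta> \<in> W_set m" and m: "1 \<le> m" and y: "y \<le> m"
  shows "gap m \<theta> y \<in> {gap m \<theta> 0, gap m \<theta> m, \<lambda>\<alpha>. gap m \<theta> (\<theta> m - 1) \<alpha> + gap m \<theta> (\<theta> m) \<alpha>}"
  using y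
proof (induction "inv \<theta> y" arbitrary: y rule: less_induct)
  case less
  show ?case
  proof (cases "y = 0 \<or> y = m")
    case False
    then have "y \<in> {1..m-1}" using less.prems by auto
    from W this show ?thesis
    proof (cases rule: gap_predecessor)
      case (1 x)
      show ?thesis
      proof (cases "x = m")
        case True
        then show ?thesis using 1(3) by simp
      next
        case False
        then show ?thesis unfolding 1(3) using 1(1,2) by (intro less.hyps) simp_all
      qed
    next
      case 2
      then show ?thesis by simp
    qed
  qed auto
qed

text \<open>The slope of a gap is a difference of two distinct indices.\<close>

lemma gap_nonzero:
  assumes \<theta>: "\<theta> \<in> Sym m" and m: "1 \<le> m" and y: "y \<le> m" "y = \<theta> m \<or> y + 1 = \<theta> m"
  shows "gap m \<theta> y \<noteq> (\<lambda>\<alpha>. 0)"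
proof
  note S = Sym_facts[OF \<theta>]
  assume "gap m \<theta> y = (\<lambda>\<alpha>. 0)"
  then have "gap m \<theta> y 1 - gap m \<theta> y 0 = 0" by simp
  \<comment> \<open>The difference of the values at 1 and 0 is the slope; the end point 1
    contributes slope 0.\<close>
  then have "inv \<theta> y = (if y = m then 0 else inv \<theta> (y+1))"
    using y(1) by (auto simp: gap_def height_def split: if_splits)
  then show False
    using y m S(5)[of m] S(6)[of y] S(6)[of "y+1"] S(7) by (cases "y = m") auto
qed

text \<open>If one of the two gaps at \<open>\<theta> m\<close> were the sum of both, the other
  would vanish identically, against \<open>gap_nonzero\<close>.\<close>

lemma gap_at_last:
  assumes W: "\<theta> \<in> W_set m" and m: "1 \<le> m"
  shows "gap m \<theta> (\<theta> m - 1) \<in> {gap m \<theta> 0, gap m \<theta> m}" "gap m \<theta> (\<theta> m) \<in> {gap m \<theta> 0, gap m \<theta> m}"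
proof -
  have \<theta>: "\<theta> \<in> Sym m" using W by (simp add: W_set_def)
  have b: "1 \<le> \<theta> m" "\<theta> m \<le> m" using Sym_facts(9)[OF \<theta>, of m] m by auto
  have "gap m \<theta> (\<theta> m - 1) \<noteq> (\<lambda>\<alpha>. gap m \<theta> (\<theta> m - 1) \<alpha> + gap m \<theta> (\<theta> m) \<alpha>)"
    using gap_nonzero[OF \<theta> m, of "\<theta> m"] b unfolding fun_eq_iff by simp
  then show "gap m \<theta> (\<theta> m - 1) \<in> {gap m \<theta> 0, gap m \<theta> m}"
    using gap_trichotomy[OF W m, of "\<theta> m - 1"] b by simp
  have "gap m \<theta> (\<theta> m) \<noteq> (\<lambda>\<alpha>. gap m \<theta> (\<theta> m - 1) \<alpha> + gap m \<theta> (\<theta> m) \<alpha>)"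
    using gap_nonzero[OF \<theta> m, of "\<theta> m - 1"] b unfolding fun_eq_iff by simp
  then show "gap m \<theta> (\<theta> m) \<in> {gap m \<theta> 0, gap m \<theta> m}"
    using gap_trichotomy[OF W m, of "\<theta> m"] b by simp
qed

text \<open>Every gap is an extreme gap or a sum of two of them, so their common sign passes to all.
  The nonpositive version serves to find \<alpha>, the positive one to sort the points.\<close>

lemma gap_sign:
  assumes W: "\<theta> \<in> W_set m" and m: "1 \<le> m" and y: "y \<le> m"
  shows "0 < gap m \<theta> 0 \<alpha> \<Longrightarrow> 0 < gap m \<theta> m \<alpha> \<Longrightarrow> 0 < gap m \<theta> y \<alpha>"
    and "gap m \<theta> 0 \<alpha> \<le> 0 \<Longrightarrow> gap m \<theta> m \<alpha> \<le> 0 \<Longrightarrow> gap m \<theta> y \<alpha> \<le> 0"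
proof -
  define B where "B y = gap m \<theta> y \<alpha>" for y
  have "B y \<in> {B 0, B m, B (\<theta> m - 1) + B (\<theta> m)}"
    using gap_trichotomy[OF W m y] unfolding B_def by (elim insertE emptyE) simp_all
  moreover have "B (\<theta> m - 1) \<in> {B 0, B m}" "B (\<theta> m) \<in> {B 0, B m}"
    using gap_at_last[OF W m] unfolding B_def by (elim insertE emptyE; simp)+
  moreover obtain g h p q where "B 0 = g" "B m = h" "B (\<theta> m - 1) = p" "B (\<theta> m) = q" by blast
  ultimately show "0 < gap m \<theta> 0 \<alpha> \<Longrightarrow> 0 < gap m \<theta> m \<alpha> \<Longrightarrow> 0 < gap m \<theta> y \<alpha>"
    and "gap m \<theta> 0 \<alpha> \<le> 0 \<Longrightarrow> gap m \<theta> m \<alpha> \<le> 0 \<Longrightarrow> gap m \<theta> y \<alpha> \<le> 0"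
    unfolding B_def[symmetric] by auto
qed

text \<open>Once all gaps are positive, the heights increase from 0 to 1 along the ranks. The height
  of \<open>\<theta> i\<close> differs from \<open>i * \<alpha>\<close> by an integer, so it is the
  fractional part, and \<theta> sorts these.\<close>

lemma W_subset_sos_inv:
  assumes m: "2 \<le> m"
  shows "W_set m \<subseteq> sos_inv m"
proof
  fix \<theta> assume W: "\<theta> \<in> W_set m"
  have m1: "1 \<le> m" using m by simp
  have \<theta>: "\<theta> \<in> Sym m" using W by (simp add: W_set_def)
  note S = Sym_facts[OF \<theta>]
  define F where "F = height m \<theta>"
  have F0: "F \<alpha> 0 = 0" and F1: "F \<alpha> (m+1) = 1" for \<alpha>
    by (simp_all add: F_def height_def S(8) descents_def)
  have sum: "(\<Sum>y<m+1. gap m \<theta> y \<alpha>) = 1" for \<alpha>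
    using sum_lessThan_telescope[of "F \<alpha>" "m+1"] F0 F1 by (simp add: gap_def F_def)
  define u v where "u = inv \<theta> 1" and "v = inv \<theta> m"
  have "u \<in> {1..m}" "v \<in> {1..m}" unfolding u_def v_def using m by (intro S(10), simp)+
  then have uv: "0 < real u" "0 < real v" by auto
  define p q where "p = real_of_int (descents \<theta> u)" and "q = real_of_int (descents \<theta> v)"
  have G: "gap m \<theta> 0 \<alpha> = real u * \<alpha> - p" for \<alpha>
    using F0[of \<alpha>] m by (simp add: gap_def F_def height_def u_def p_def)
  have H: "gap m \<theta> m \<alpha> = 1 + q - real v * \<alpha>" for \<alpha>
    by (simp add: gap_def height_def v_def q_def)
  \<comment> \<open>All gaps add up to \<open>1\<close>, so the extreme gaps cannot both be nonpositive. At \<open>\<alpha> = p / u\<close>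
    the lower one vanishes, and a slightly larger \<open>\<alpha>\<close> makes both positive.\<close>
  have H0: "0 < gap m \<theta> m (p / u)"
  proof (rule ccontr)
    assume neg: "\<not> ?thesis"
    have "gap m \<theta> y (p / u) \<le> 0" if "y \<in> {..<m+1}" for y
    proof (rule gap_sign(2)[OF W m1])
      show "gap m \<theta> 0 (p / u) \<le> 0" using uv by (simp add: G)
    qed (use that neg in auto)
    then have "(\<Sum>y<m+1. gap m \<theta> y (p / u)) \<le> 0" by (rule sum_nonpos)
    then show False using sum[of "p / u"] by simp
  qed
  define h where "h = gap m \<theta> m (p / u)"
  have h: "0 < h" "1 + q - real v * (p / u) = h" using H0 H[of "p / u"] by (simp_all add: h_def)
  \<comment> \<open>The upper gap has slope \<open>-v\<close>, so this increment spends half of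
    \<open>h\<close> and leaves \<open>h / 2\<close>.\<close>
  define \<alpha> where "\<alpha> = p / u + h / (2 * v)"
  have "0 < gap m \<theta> 0 \<alpha>" unfolding G \<alpha>_def using uv h(1) by (simp add: field_simps)
  moreover have "0 < gap m \<theta> m \<alpha>"
  proof -
    have "gap m \<theta> m \<alpha> = (1 + q - real v * (p / u)) - real v * (h / (2 * v))"
      unfolding H \<alpha>_def by (simp add: distrib_left)
    also have "\<dots> = h / 2" using uv unfolding h(2) by simp
    finally show ?thesis using h(1) by simp
  qed
  ultimately have pos: "F \<alpha> y < F \<alpha> (y+1)" if "y < m + 1" for y
    using gap_sign(1)[OF W m1, of y \<alpha>] that by (simp add: gap_def F_def)
  have mono: "F \<alpha> x < F \<alpha> y" if "x < y" "y \<le> m + 1" for x y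
    using that
  proof (induction y)
    case (Suc y)
    then show ?case using pos[of y] by (cases "x = y") auto
  qed simp
  have frac: "frac (real i * \<alpha>) = F \<alpha> (\<theta> i)" and pos': "0 < F \<alpha> (\<theta> i)" if i: "i \<in> {1..m}" for i
  proof -
    have r: "1 \<le> \<theta> i" "\<theta> i \<le> m" using S(9)[OF i] by auto
    then show "0 < F \<alpha> (\<theta> i)" using mono[of 0 "\<theta> i"] F0 by simp
    moreover have "F \<alpha> (\<theta> i) < 1" using mono[of "\<theta> i" "m+1"] F1 r by simp
    ultimately show "frac (real i * \<alpha>) = F \<alpha> (\<theta> i)"
      unfolding frac_unique_iff using r by (simp add: F_def height_def S(5))
  qed
  show "\<theta> \<in> sos_inv m"
    unfolding sos_inv_iff[OF m1]
  proof (intro conjI \<theta> exI[of _ \<alpha>] ballI impI)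
    show "0 < frac (real i * \<alpha>)" if "i \<in> {1..m}" for i using frac[OF that] pos'[OF that] by simp
    show "frac (real i * \<alpha>) < frac (real j * \<alpha>)" if "i \<in> {1..m}" "j \<in> {1..m}" "\<theta> i < \<theta> j" for i j
      unfolding frac[OF that(1)] frac[OF that(2)] using mono[OF that(3)] S(9)[OF that(2)] by simp
  qed
qed

theorem corollary1:
  fixes m :: nat
  assumes "m \<ge> 2"
  shows "sos_inv m = V_set m \<and> V_set m = W_set m \<and>
         shift_closure m (sos_inv m) = Y_set m \<and>
         Y_set m = shift_closure m (V_set m) \<and>
         shift_closure m (V_set m) = shift_closure m (W_set m) \<and>
         sos_type_inv m = Y_set m"
proof -
  have sos: "sos_inv m = V_set m"
    using sos_inv_subset_W[OF assms] W_subset_sos_inv[OF assms] V_eq_W by blast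
  \<comment> \<open>Three inclusions close a cycle: from the shift closure to Sos type, on to
    \<open>Y_set\<close>, and back to the shift closure.\<close>
  have "shift_closure m (sos_inv m) = Y_set m" "sos_type_inv m = Y_set m"
    using shift_closure_sos_inv_subset[OF assms] sos_type_inv_subset_Y[OF assms]
      Y_subset_shift_closure_V[OF assms] unfolding sos by blast+
  then show ?thesis using sos V_eq_W[of m] by simp
qed

end
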